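(* Let $G$ be a diffeological group, and let $EG$ be the (diffeological) infinite join of countably many copies of $G$. Then $EG$ is smoothly contractible.
   Context: Diffeology. A diffeology on a set $X$ is a collection of maps $p\colon U\to X$ ("plots"), $U$ open in some $\mathbb{R}^n$, $n\ge 0$, that contains constant maps, is closed under precomposition with smooth maps between open subsets of Euclidean spaces, and contains every map that is locally a plot. A map is smooth if its composition with every plot is a plot. Subsets carry the subset diffeology (plots of $X$ with image in the subset), products the product diffeology (maps all of whose components are plots), quotients the quotient diffeology (maps that locally lift to plots); $[0,1]\subseteq\mathbb{R}$ has the subset diffeology. A diffeological group is a group with a diffeology for which multiplication and inversion are smooth. A diffeological space $Y$ is smoothly contractible if there is a smooth homotopy $H\colon Y\times[0,1]\to Y$ from the identity of $Y$ to a constant map. Milnor construction. Let $S_G\subseteq[0,1]^{\mathbb{N}}\times G^{\mathbb{N}}$ be the set of $(t_i,g_i)_{i\in\mathbb{N}}$ with only finitely many $t_i\ne 0$ and $\sum_i t_i=1$, with the subset diffeology of the product diffeology. Define $(t_i,g_i)\sim(t_i',g_i')$ iff $t_i=t_i'$ for all $i$ and $g_i=g_i'$ whenever $t_i=t'_i\neq0$. Then $EG:=S_G/\!\sim$ with the quotient diffeology. *)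

theory Defs
  imports "HOL-Analysis.Analysis" "HOL-Algebra.Group"
begin

text \<open>
  The Euclidean space of dimension \<open>n\<close> is the library's \<^const>\<open>Euclidean_space\<close>: the
  sequences of reals vanishing at all indices \<open>\<ge> n\<close>, with the topology of pointwise
  convergence. This allows quantification over the dimension of the domain of a plot.
\<close>

definition partial_deriv :: "nat \<Rightarrow> ((nat \<Rightarrow> real) \<Rightarrow> real) \<Rightarrow> (nat \<Rightarrow> real) \<Rightarrow> real" where
  "partial_deriv i f x = deriv (\<lambda>s. f (x(i := s))) (x i)"

text \<open>For \<open>U\<close> open in \<open>n\<close>-dimensional space; only the values of \<open>f\<close> on \<open>U\<close> matter.\<close>

primrec Ck_on :: "nat \<Rightarrow> nat \<Rightarrow> (nat \<Rightarrow> real) set \<Rightarrow> ((nat \<Rightarrow> real) \<Rightarrow> real) \<Rightarrow> bool" where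
  "Ck_on n 0 U f \<longleftrightarrow> continuous_map (subtopology (Euclidean_space n) U) euclideanreal f"
| "Ck_on n (Suc k) U f \<longleftrightarrow>
     continuous_map (subtopology (Euclidean_space n) U) euclideanreal f \<and>
     (\<forall>i<n. (\<forall>x\<in>U. (\<lambda>s. f (x(i := s))) differentiable (at (x i))) \<and>
            Ck_on n k U (partial_deriv i f))"

definition smooth_fun_on :: "nat \<Rightarrow> (nat \<Rightarrow> real) set \<Rightarrow> ((nat \<Rightarrow> real) \<Rightarrow> real) \<Rightarrow> bool" where
  "smooth_fun_on n U f \<longleftrightarrow> (\<forall>k. Ck_on n k U f)"

definition smooth_between ::
    "nat \<Rightarrow> (nat \<Rightarrow> real) set \<Rightarrow> nat \<Rightarrow> (nat \<Rightarrow> real) set \<Rightarrow> ((nat \<Rightarrow> real) \<Rightarrow> nat \<Rightarrow> real) \<Rightarrow> bool" where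
  "smooth_between m V n U h \<longleftrightarrow>
     h \<in> V \<rightarrow> U \<and> (\<forall>j<n. smooth_fun_on m V (\<lambda>x. h x j))"

text \<open>
  \<open>D n U p\<close> says that the restriction of \<open>p\<close> to \<open>U\<close>, an open subset of \<open>n\<close>-dimensional
  space, is a plot. As \<open>p\<close> is a total function, a diffeology is required not to depend on
  its values outside \<open>U\<close> (the second clause below).
\<close>

type_synonym 'a plots = "nat \<Rightarrow> (nat \<Rightarrow> real) set \<Rightarrow> ((nat \<Rightarrow> real) \<Rightarrow> 'a) \<Rightarrow> bool"

definition diffeology_on :: "'a set \<Rightarrow> 'a plots \<Rightarrow> bool" where
  "diffeology_on X D \<longleftrightarrow>
     (\<forall>n U p. D n U p \<longrightarrow> openin (Euclidean_space n) U \<and> p \<in> U \<rightarrow> X) \<and>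
     (\<forall>n U p q. D n U p \<and> (\<forall>u\<in>U. q u = p u) \<longrightarrow> D n U q) \<and>
     (\<forall>n U. \<forall>x\<in>X. openin (Euclidean_space n) U \<longrightarrow> D n U (\<lambda>_. x)) \<and>
     (\<forall>n U p m V h. D n U p \<and> openin (Euclidean_space m) V \<and> smooth_between m V n U h
        \<longrightarrow> D m V (p \<circ> h)) \<and>
     (\<forall>n U p. openin (Euclidean_space n) U \<and>
        (\<forall>u\<in>U. \<exists>V. openin (Euclidean_space n) V \<and> u \<in> V \<and> V \<subseteq> U \<and> D n V p)
        \<longrightarrow> D n U p)"

definition diffeo_smooth :: "'a set \<Rightarrow> 'a plots \<Rightarrow> 'b set \<Rightarrow> 'b plots \<Rightarrow> ('a \<Rightarrow> 'b) \<Rightarrow> bool" where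
  "diffeo_smooth X D Y E f \<longleftrightarrow>
     f \<in> X \<rightarrow> Y \<and> (\<forall>n U p. D n U p \<longrightarrow> E n U (f \<circ> p))"

definition real_plots :: "real plots" where
  "real_plots n U p \<longleftrightarrow> openin (Euclidean_space n) U \<and> smooth_fun_on n U p"

definition subset_plots :: "'a plots \<Rightarrow> 'a set \<Rightarrow> 'a plots" where
  "subset_plots D A n U p \<longleftrightarrow> D n U p \<and> p \<in> U \<rightarrow> A"

definition unit_interval_plots :: "real plots" where
  "unit_interval_plots = subset_plots real_plots {0..1}"

definition prod_plots :: "'a plots \<Rightarrow> 'b plots \<Rightarrow> ('a \<times> 'b) plots" where
  "prod_plots D E n U p \<longleftrightarrow> D n U (fst \<circ> p) \<and> E n U (snd \<circ> p)"

definition power_plots :: "'a plots \<Rightarrow> (nat \<Rightarrow> 'a) plots" where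
  "power_plots D n U p \<longleftrightarrow> (\<forall>i. D n U (\<lambda>u. p u i))"

text \<open>The quotient diffeology on \<open>X // r\<close>, where \<open>D\<close> is a diffeology on \<open>X\<close>.\<close>

definition quotient_plots :: "'a plots \<Rightarrow> ('a \<times> 'a) set \<Rightarrow> 'a set plots" where
  "quotient_plots D r n U p \<longleftrightarrow>
     openin (Euclidean_space n) U \<and>
     (\<forall>u\<in>U. \<exists>V q. openin (Euclidean_space n) V \<and> u \<in> V \<and> V \<subseteq> U \<and>
        D n V q \<and> (\<forall>v\<in>V. p v = r `` {q v}))"

definition smoothly_contractible :: "'a set \<Rightarrow> 'a plots \<Rightarrow> bool" where
  "smoothly_contractible Y E \<longleftrightarrow>
     (\<exists>H. \<exists>c\<in>Y.
        diffeo_smooth (Y \<times> {0..1}) (prod_plots E unit_interval_plots) Y E H \<and>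
        (\<forall>y\<in>Y. H (y, 0) = y) \<and> (\<forall>y\<in>Y. H (y, 1) = c))"

definition diffeological_group :: "('a, 'b) monoid_scheme \<Rightarrow> 'a plots \<Rightarrow> bool" where
  "diffeological_group G D \<longleftrightarrow>
     group G \<and> diffeology_on (carrier G) D \<and>
     diffeo_smooth (carrier G \<times> carrier G) (prod_plots D D) (carrier G) D
       (\<lambda>(x, y). x \<otimes>\<^bsub>G\<^esub> y) \<and>
     diffeo_smooth (carrier G) D (carrier G) D (\<lambda>x. inv\<^bsub>G\<^esub> x)"

definition milnor_S :: "('a, 'b) monoid_scheme \<Rightarrow> ((nat \<Rightarrow> real) \<times> (nat \<Rightarrow> 'a)) set" where
  "milnor_S G =
     {(t, g). (\<forall>i. t i \<in> {0..1}) \<and> (\<forall>i. g i \<in> carrier G) \<and>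
              finite {i. t i \<noteq> 0} \<and> (\<Sum>i | t i \<noteq> 0. t i) = 1}"

definition milnor_S_plots ::
    "('a, 'b) monoid_scheme \<Rightarrow> 'a plots \<Rightarrow> ((nat \<Rightarrow> real) \<times> (nat \<Rightarrow> 'a)) plots" where
  "milnor_S_plots G D =
     subset_plots (prod_plots (power_plots unit_interval_plots) (power_plots D)) (milnor_S G)"

definition milnor_rel ::
    "('a, 'b) monoid_scheme \<Rightarrow>
      (((nat \<Rightarrow> real) \<times> (nat \<Rightarrow> 'a)) \<times> ((nat \<Rightarrow> real) \<times> (nat \<Rightarrow> 'a))) set" where
  "milnor_rel G =
     {((t, g), (t', g')). (t, g) \<in> milnor_S G \<and> (t', g') \<in> milnor_S G \<and>
        (\<forall>i. t i = t' i) \<and> (\<forall>i. t i \<noteq> 0 \<longrightarrow> g i = g' i)}"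

definition EG :: "('a, 'b) monoid_scheme \<Rightarrow> ((nat \<Rightarrow> real) \<times> (nat \<Rightarrow> 'a)) set set" where
  "EG G = milnor_S G // milnor_rel G"

definition EG_plots ::
    "('a, 'b) monoid_scheme \<Rightarrow> 'a plots \<Rightarrow> ((nat \<Rightarrow> real) \<times> (nat \<Rightarrow> 'a)) set plots" where
  "EG_plots G D = quotient_plots (milnor_S_plots G D) (milnor_rel G)"

end

(* The difficulty is that the supports of the t_i need not be locally finite along a plot, and that
   in general no path in G joins different labels; so near every point of a plot the label of
   every index must be fixed at once.  All weights are therefore expressed through the partial sums
   T_i = t_0 + ... + t_(i-1).  In a first stage the weights t_i are deformed linearly into the
   increments of f(T_i), where f increases from 0 to 1 on [0,1/5]; these are locally finite.  In a
   second stage they are deformed linearly into the increments of h(T_i), where h increases from 0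
   to 1 on [4/5,1], placed one index higher together with their labels.  Where T_i > 1/5 the old
   weight at i vanishes, and where T_i < 4/5 the new one does, so index i locally needs one label
   only; and T_i > 1/5 holds near any given point for all large i simultaneously.  Index 0 is now
   free, and all mass is moved there linearly, with label 1. *)
theory Submission
  imports Defs
begin

section \<open>Smooth functions on open subsets of Euclidean space\<close>

text \<open>The coordinate line through \<open>x\<close> is continuous into the space, as
  \<open>i < n\<close> keeps all coordinates from \<open>n\<close> on at 0. Hence a partial
  derivative at a point of \<open>U\<close> sees only values on \<open>U\<close>.\<close>

lemma eventually_fun_upd_in:
  assumes U: "openin (Euclidean_space n) U" and "x \<in> U" "i < n"
  shows "\<forall>\<^sub>F s in nhds (x i). x(i := s) \<in> U"
proof -
  have x: "\<forall>j\<ge>n. x j = 0"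
    using assms openin_subset[OF U] by (auto simp: topspace_Euclidean_space)
  have "continuous_map euclideanreal (Euclidean_space n) (\<lambda>s. x(i := s))"
    unfolding Euclidean_space_def continuous_map_in_subtopology continuous_map_componentwise_UNIV
    using x \<open>i < n\<close> by (auto simp: fun_upd_def continuous_map_id[unfolded id_def])
  from openin_continuous_map_preimage[OF this U]
  have "open {s. x(i := s) \<in> U}"
    by simp
  with \<open>x \<in> U\<close> show ?thesis
    unfolding eventually_nhds by (intro exI[of _ "{s. x(i := s) \<in> U}"]) auto
qed

lemma Ck_on_SucI:
  assumes "continuous_map (subtopology (Euclidean_space n) U) euclideanreal f"
    and "\<And>i x. i < n \<Longrightarrow> x \<in> U \<Longrightarrow>
          ((\<lambda>s. f (x(i := s))) has_real_derivative f' i x) (at (x i))"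
    and "\<And>i. i < n \<Longrightarrow> Ck_on n k U (partial_deriv i f)"
  shows "Ck_on n (Suc k) U f"
  using assms by (auto simp: real_differentiable_def)

lemma Ck_on_cong:
  assumes U: "openin (Euclidean_space n) U"
  shows "(\<And>x. x \<in> U \<Longrightarrow> f x = g x) \<Longrightarrow> Ck_on n k U f \<Longrightarrow> Ck_on n k U g"
proof (induction k arbitrary: f g)
  case 0
  then show ?case
    by (auto intro: continuous_map_eq)
next
  case (Suc k)
  have ev: "\<forall>\<^sub>F s in nhds (x i). f (x(i := s)) = g (x(i := s))" if "x \<in> U" "i < n" for x i
    using eventually_fun_upd_in[OF U that] by eventually_elim (rule Suc.prems(1))
  have "continuous_map (subtopology (Euclidean_space n) U) euclideanreal g"
    using Suc.prems by (auto intro: continuous_map_eq)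
  moreover have "(\<lambda>s. g (x(i := s))) differentiable (at (x i))" if "x \<in> U" "i < n" for x i
  proof -
    have "(\<lambda>s. f (x(i := s))) differentiable (at (x i))"
      using Suc.prems(2) that by auto
    then obtain d where "((\<lambda>s. f (x(i := s))) has_real_derivative d) (at (x i))"
      by (auto simp: real_differentiable_def)
    then have "((\<lambda>s. g (x(i := s))) has_real_derivative d) (at (x i))"
      using DERIV_cong_ev[OF refl ev[OF that] refl] by blast
    then show ?thesis
      by (auto simp: real_differentiable_def)
  qed
  moreover have "Ck_on n k U (partial_deriv i g)" if "i < n" for i
  proof (rule Suc.IH)
    show "Ck_on n k U (partial_deriv i f)"
      using Suc.prems(2) that by simp
    show "partial_deriv i f x = partial_deriv i g x" if "x \<in> U" for x
      unfolding partial_deriv_def using ev[OF that \<open>i < n\<close>] by (intro deriv_cong_ev) auto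
  qed
  ultimately show ?case
    by simp
qed

lemma Ck_on_has_partial_deriv:
  assumes "Ck_on n (Suc k) U f" "x \<in> U" "i < n"
  shows "((\<lambda>s. f (x(i := s))) has_real_derivative partial_deriv i f x) (at (x i))"
  using assms unfolding partial_deriv_def by (auto simp: DERIV_deriv_iff_real_differentiable)

text \<open>Working form of the recursion: \<open>partial_deriv\<close> may be replaced by any
  explicit formula that is correct on \<open>U\<close>, by \<open>Ck_on_cong\<close>.\<close>

lemma Ck_on_SucI':
  assumes U: "openin (Euclidean_space n) U"
    and "continuous_map (subtopology (Euclidean_space n) U) euclideanreal f"
    and der: "\<And>i x. i < n \<Longrightarrow> x \<in> U \<Longrightarrow>
          ((\<lambda>s. f (x(i := s))) has_real_derivative f' i x) (at (x i))"
    and Ck: "\<And>i. i < n \<Longrightarrow> Ck_on n k U (f' i)"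
  shows "Ck_on n (Suc k) U f"
proof (rule Ck_on_SucI)
  show "Ck_on n k U (partial_deriv i f)" if "i < n" for i
    by (rule Ck_on_cong[OF U _ Ck[OF that]])
      (use der that in \<open>auto simp: partial_deriv_def intro!: DERIV_imp_deriv[symmetric]\<close>)
qed (use assms in auto)

section \<open>Closure properties of C^k and smooth functions\<close>

lemma Ck_on_continuous:
  "Ck_on n k U f \<Longrightarrow> continuous_map (subtopology (Euclidean_space n) U) euclideanreal f"
  by (cases k) auto

lemma Ck_on_SucD: "Ck_on n (Suc k) U f \<Longrightarrow> Ck_on n k U f"
  by (induction k arbitrary: f) auto

lemma Ck_on_subset: "Ck_on n k U f \<Longrightarrow> V \<subseteq> U \<Longrightarrow> Ck_on n k V f"
  by (induction k arbitrary: f) (auto intro: continuous_map_from_subtopology_mono)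

lemma Ck_on_const:
  assumes U: "openin (Euclidean_space n) U"
  shows "Ck_on n k U (\<lambda>_. c)"
proof (induction k arbitrary: c)
  case (Suc k)
  then show ?case
    by (intro Ck_on_SucI'[OF U, where f' = "\<lambda>_ _. 0"]) auto
qed simp

lemma Ck_on_coordinate:
  assumes U: "openin (Euclidean_space n) U"
  shows "Ck_on n k U (\<lambda>x. x j)"
proof -
  have cont: "continuous_map (subtopology (Euclidean_space n) U) euclideanreal (\<lambda>x. x j)"
    unfolding Euclidean_space_def
    by (intro continuous_map_from_subtopology continuous_map_product_projection) auto
  show ?thesis
  proof (cases k)
    case (Suc k')
    have "((\<lambda>s. (x(i := s)) j) has_real_derivative (if i = j then 1 else 0)) (at (x i))"
      for x :: "nat \<Rightarrow> real" and i
      by (cases "i = j") auto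
    then show ?thesis
      unfolding Suc using Ck_on_const[OF U] by (intro Ck_on_SucI'[OF U cont])
  qed (use cont in simp)
qed

lemma Ck_on_add:
  assumes U: "openin (Euclidean_space n) U"
  shows "Ck_on n k U f \<Longrightarrow> Ck_on n k U g \<Longrightarrow> Ck_on n k U (\<lambda>x. f x + g x)"
proof (induction k arbitrary: f g)
  case 0
  then show ?case
    by (auto intro: continuous_map_add)
next
  case (Suc k)
  show ?case
  proof (rule Ck_on_SucI'[OF U])
    show "continuous_map (subtopology (Euclidean_space n) U) euclideanreal (\<lambda>x. f x + g x)"
      using Suc.prems by (auto intro: continuous_map_add)
    show "((\<lambda>s. f (x(i := s)) + g (x(i := s))) has_real_derivative
        partial_deriv i f x + partial_deriv i g x) (at (x i))" if "i < n" "x \<in> U" for i x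
      using Suc.prems that by (intro DERIV_add Ck_on_has_partial_deriv)
    show "Ck_on n k U (\<lambda>x. partial_deriv i f x + partial_deriv i g x)" if "i < n" for i
      using Suc.prems that by (intro Suc.IH) auto
  qed
qed

lemma Ck_on_mult:
  assumes U: "openin (Euclidean_space n) U"
  shows "Ck_on n k U f \<Longrightarrow> Ck_on n k U g \<Longrightarrow> Ck_on n k U (\<lambda>x. f x * g x)"
proof (induction k arbitrary: f g)
  case 0
  then show ?case
    by (auto intro: continuous_map_real_mult)
next
  case (Suc k)
  show ?case
  proof (rule Ck_on_SucI'[OF U])
    show "continuous_map (subtopology (Euclidean_space n) U) euclideanreal (\<lambda>x. f x * g x)"
      using Suc.prems by (auto intro: continuous_map_real_mult)
    show "((\<lambda>s. f (x(i := s)) * g (x(i := s))) has_real_derivative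
        partial_deriv i f x * g x + partial_deriv i g x * f x) (at (x i))"
      if "i < n" "x \<in> U" for i x
      using DERIV_mult[OF Ck_on_has_partial_deriv[OF Suc.prems(1) that(2,1)]
          Ck_on_has_partial_deriv[OF Suc.prems(2) that(2,1)]]
      by (simp only: fun_upd_triv)
    show "Ck_on n k U (\<lambda>x. partial_deriv i f x * g x + partial_deriv i g x * f x)" if "i < n" for i
      using Suc.prems that by (intro Ck_on_add[OF U] Suc.IH) (auto simp: Ck_on_SucD)
  qed
qed

text \<open>That \<open>\<F>\<close> is closed under differentiation encodes the infinite differentiability of its members.\<close>

lemma Ck_on_compose:
  assumes U: "openin (Euclidean_space n) U"
    and closed: "\<And>\<phi>. \<phi> \<in> \<F> \<Longrightarrow> \<exists>\<phi>'\<in>\<F>. \<forall>x::real. (\<phi> has_real_derivative \<phi>' x) (at x)"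
    and f: "smooth_fun_on n U f"
  shows "\<phi> \<in> \<F> \<Longrightarrow> Ck_on n k U (\<lambda>x. \<phi> (f x))"
proof (induction k arbitrary: \<phi>)
  case 0
  then have "continuous_on UNIV \<phi>"
    using closed by (meson DERIV_continuous_on has_field_derivative_at_within)
  then have "continuous_map (subtopology (Euclidean_space n) U) euclideanreal (\<phi> \<circ> f)"
    using f[unfolded smooth_fun_on_def]
    by (intro continuous_map_compose[of _ euclideanreal]) (auto dest: Ck_on_continuous)
  then show ?case
    by (simp add: o_def)
next
  case (Suc k)
  from closed[OF Suc.prems] obtain \<phi>' where \<phi>': "\<phi>' \<in> \<F>"
    "\<And>x. (\<phi> has_real_derivative \<phi>' x) (at x)" by blast
  have f': "Ck_on n (Suc k) U f"
    using f unfolding smooth_fun_on_def by blast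
  show ?case
  proof (rule Ck_on_SucI'[OF U])
    show "continuous_map (subtopology (Euclidean_space n) U) euclideanreal (\<lambda>x. \<phi> (f x))"
      by (rule Ck_on_continuous[OF Suc.IH[OF Suc.prems]])
    show "((\<lambda>s. \<phi> (f (x(i := s)))) has_real_derivative
        \<phi>' (f x) * partial_deriv i f x) (at (x i))" if "i < n" "x \<in> U" for i x
      using DERIV_chain2[OF \<phi>'(2) Ck_on_has_partial_deriv[OF f' that(2,1)]] by simp
    show "Ck_on n k U (\<lambda>x. \<phi>' (f x) * partial_deriv i f x)" if "i < n" for i
      using Ck_on_mult[OF U Suc.IH[OF \<phi>'(1)]] f' that by simp
  qed
qed

lemma smooth_fun_on_const:
  "openin (Euclidean_space n) U \<Longrightarrow> smooth_fun_on n U (\<lambda>_. c)"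
  by (simp add: smooth_fun_on_def Ck_on_const)

lemma smooth_fun_on_coordinate:
  "openin (Euclidean_space n) U \<Longrightarrow> smooth_fun_on n U (\<lambda>x. x j)"
  by (simp add: smooth_fun_on_def Ck_on_coordinate)

lemma smooth_fun_on_add:
  "openin (Euclidean_space n) U \<Longrightarrow> smooth_fun_on n U f \<Longrightarrow> smooth_fun_on n U g \<Longrightarrow>
    smooth_fun_on n U (\<lambda>x. f x + g x)"
  by (simp add: smooth_fun_on_def Ck_on_add)

lemma smooth_fun_on_mult:
  "openin (Euclidean_space n) U \<Longrightarrow> smooth_fun_on n U f \<Longrightarrow> smooth_fun_on n U g \<Longrightarrow>
    smooth_fun_on n U (\<lambda>x. f x * g x)"
  by (simp add: smooth_fun_on_def Ck_on_mult)

lemma smooth_fun_on_diff: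
  assumes "openin (Euclidean_space n) U" "smooth_fun_on n U f" "smooth_fun_on n U g"
  shows "smooth_fun_on n U (\<lambda>x. f x - g x)"
  using smooth_fun_on_add[OF assms(1,2) smooth_fun_on_mult[OF assms(1)
        smooth_fun_on_const[OF assms(1), of "-1"] assms(3)]] by simp

lemma smooth_fun_on_sum:
  "openin (Euclidean_space n) U \<Longrightarrow> (\<And>i. i \<in> I \<Longrightarrow> smooth_fun_on n U (f i)) \<Longrightarrow>
    smooth_fun_on n U (\<lambda>x. \<Sum>i\<in>I. f i x)"
  by (induction I rule: infinite_finite_induct) (auto intro: smooth_fun_on_const smooth_fun_on_add)

lemma smooth_fun_on_subset:
  "smooth_fun_on n U f \<Longrightarrow> V \<subseteq> U \<Longrightarrow> smooth_fun_on n V f"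
  by (auto simp: smooth_fun_on_def intro: Ck_on_subset)

lemma smooth_fun_on_openin_preimage:
  assumes U: "openin (Euclidean_space n) U" and f: "smooth_fun_on n U f" and S: "open S"
  shows "openin (Euclidean_space n) {u \<in> U. f u \<in> S}"
proof -
  have "continuous_map (subtopology (Euclidean_space n) U) euclideanreal f"
    using f by (auto simp: smooth_fun_on_def dest: Ck_on_continuous)
  from openin_continuous_map_preimage[OF this, of S] S
  have "openin (subtopology (Euclidean_space n) U)
      {u \<in> topspace (subtopology (Euclidean_space n) U). f u \<in> S}"
    by simp
  also have "topspace (subtopology (Euclidean_space n) U) = U"
    using openin_subset[OF U] by auto
  finally have "openin (subtopology (Euclidean_space n) U) {u \<in> U. f u \<in> S}" .
  then show ?thesis
    using openin_trans_full U by blast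
qed

section \<open>A smooth step function\<close>

text \<open>For \<open>m = 0\<close> this is the classical flat function exp(-1/x). The powers of
  1/x are included so that derivatives are combinations of members of the same family.\<close>

definition flat_exp :: "nat \<Rightarrow> real \<Rightarrow> real" where
  "flat_exp m x = (if x \<le> 0 then 0 else inverse x ^ m * exp (- inverse x))"

text \<open>For y = 1/x > 0 the exponential series dominates its single term of degree
  \<open>m + 2\<close>. The quadratic bound gives derivative 0 at the origin.\<close>

lemma flat_exp_bound: "\<bar>flat_exp m x\<bar> \<le> fact (m + 2) * x\<^sup>2"
proof (cases "x \<le> 0")
  case False
  define y where "y = inverse x"
  have y: "y > 0" using False by (simp add: y_def)
  have "(\<lambda>n. y ^ n /\<^sub>R fact n) sums exp y"
    by (rule exp_converges)
  then have "(\<Sum>n\<in>{m+2}. y ^ n /\<^sub>R fact n) \<le> exp y"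
    using y by (intro order.trans[OF sum_le_suminf]) (auto simp: sums_iff simp del: fact_Suc)
  then have "y ^ (m + 2) \<le> fact (m + 2) * exp y"
    by (simp add: field_simps del: fact_Suc)
  then have "y ^ m * exp (- y) \<le> fact (m + 2) * (inverse y)\<^sup>2"
    using y by (simp add: exp_minus field_simps power_add power2_eq_square del: fact_Suc)
  then show ?thesis
    using False y by (simp add: flat_exp_def y_def abs_mult del: fact_Suc)
qed (simp add: flat_exp_def)

text \<open>Away from 0 the function agrees locally with 0 or with its closed formula; at 0 the
  difference quotient is squeezed by \<open>flat_exp_bound\<close>.\<close>

lemma DERIV_flat_exp:
  "(flat_exp m has_real_derivative flat_exp (m + 2) x - m * flat_exp (m + 1) x) (at x)"
proof -
  consider "x < 0" | "x = 0" | "x > 0" by linarith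
  then show ?thesis
  proof cases
    case 1
    have "(flat_exp m has_real_derivative 0) (at x)"
      by (rule has_field_derivative_transform_within_open[OF DERIV_const[of 0], of "{..<0}"])
        (use 1 in \<open>auto simp: flat_exp_def\<close>)
    with 1 show ?thesis by (simp add: flat_exp_def)
  next
    case 2
    have "((\<lambda>h. flat_exp m h / h) \<longlongrightarrow> 0) (at 0)"
    proof (rule Lim_null_comparison)
      show "\<forall>\<^sub>F h in at 0. norm (flat_exp m h / h) \<le> fact (m + 2) * \<bar>h\<bar>"
        using flat_exp_bound[of m]
        by (intro always_eventually)
          (auto simp: divide_simps power2_eq_square mult.assoc simp del: fact_Suc)
      show "((\<lambda>h::real. fact (m + 2) * \<bar>h\<bar>) \<longlongrightarrow> 0) (at 0)"
        by (auto intro!: tendsto_eq_intros)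
    qed
    with 2 show ?thesis by (simp add: DERIV_def flat_exp_def)
  next
    case 3
    have inv: "(inverse has_real_derivative - (inverse x)\<^sup>2) (at x)"
      using DERIV_inverse[of x UNIV] 3 by (simp add: power2_eq_square)
    have E: "((\<lambda>x. exp (- inverse x)) has_real_derivative exp (- inverse x) * (inverse x)\<^sup>2) (at x)"
      using DERIV_chain2[OF DERIV_exp DERIV_minus[OF inv]] by simp
    have P: "((\<lambda>x. inverse x ^ m) has_real_derivative - (m * inverse x ^ (m + 1))) (at x)"
      using DERIV_power[OF inv, of m] by (cases m) (simp_all add: power2_eq_square mult_ac)
    have "((\<lambda>x. inverse x ^ m * exp (- inverse x)) has_real_derivative
        flat_exp (m + 2) x - m * flat_exp (m + 1) x) (at x)"
      by (rule DERIV_cong[OF DERIV_mult[OF P E]])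
        (use 3 in \<open>simp add: flat_exp_def power2_eq_square algebra_simps\<close>)
    then show ?thesis
      by (rule has_field_derivative_transform_within_open[of _ _ _ "{0<..}"])
        (use 3 in \<open>auto simp: flat_exp_def\<close>)
  qed
qed

definition step_denom :: "real \<Rightarrow> real" where
  "step_denom x = flat_exp 0 x + flat_exp 0 (1 - x)"

definition smooth_step :: "real \<Rightarrow> real" where
  "smooth_step x = flat_exp 0 x * inverse (step_denom x)"

lemma step_denom_pos: "step_denom x > 0"
  unfolding step_denom_def flat_exp_def by (auto intro: add_pos_pos)

text \<open>A class closed under differentiation that contains \<open>smooth_step\<close>, to be
  used as \<F> in \<open>Ck_on_compose\<close>. The reciprocal of the denominator is a generator
  because its derivative is a product of itself, twice, with a derivative of the
  denominator.\<close>

inductive_set step_algebra :: "(real \<Rightarrow> real) set" where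
  const: "(\<lambda>_. c) \<in> step_algebra"
| flat: "flat_exp m \<in> step_algebra"
| reflected: "(\<lambda>x. flat_exp m (1 - x)) \<in> step_algebra"
| inverse_denom: "(\<lambda>x. inverse (step_denom x)) \<in> step_algebra"
| add: "f \<in> step_algebra \<Longrightarrow> g \<in> step_algebra \<Longrightarrow> (\<lambda>x. f x + g x) \<in> step_algebra"
| mult: "f \<in> step_algebra \<Longrightarrow> g \<in> step_algebra \<Longrightarrow> (\<lambda>x. f x * g x) \<in> step_algebra"

lemma step_algebra_diff:
  assumes "f \<in> step_algebra" "g \<in> step_algebra"
  shows "(\<lambda>x. f x - g x) \<in> step_algebra"
  using step_algebra.add[OF assms(1) step_algebra.mult[OF step_algebra.const[of "-1"] assms(2)]]
  by simp

lemma step_algebra_flat_deriv: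
  "(\<lambda>x. flat_exp (m + 2) x - m * flat_exp (m + 1) x) \<in> step_algebra"
  by (intro step_algebra_diff step_algebra.intros)

lemma step_algebra_reflected_deriv:
  "(\<lambda>x. - 1 * (flat_exp (m + 2) (1 - x) - m * flat_exp (m + 1) (1 - x))) \<in> step_algebra"
  by (intro step_algebra_diff step_algebra.intros)

lemma DERIV_flat_exp_reflected:
  "((\<lambda>x. flat_exp m (1 - x)) has_real_derivative
    - 1 * (flat_exp (m + 2) (1 - x) - m * flat_exp (m + 1) (1 - x))) (at x)"
proof -
  have "((\<lambda>x::real. 1 - x) has_real_derivative - 1) (at x)"
    by (auto intro!: derivative_eq_intros)
  from DERIV_chain2[OF DERIV_flat_exp this] show ?thesis
    by (simp only: mult.commute)
qed

lemma step_algebra_closed_deriv: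
  "f \<in> step_algebra \<Longrightarrow> \<exists>f'\<in>step_algebra. \<forall>x. (f has_real_derivative f' x) (at x)"
proof (induction rule: step_algebra.induct)
  case (const c)
  show ?case
    by (rule bexI[of _ "\<lambda>_. 0"]) (auto intro: step_algebra.const)
next
  case (flat m)
  show ?case
    using DERIV_flat_exp step_algebra_flat_deriv by (rule_tac bexI) auto
next
  case (reflected m)
  show ?case
    using DERIV_flat_exp_reflected step_algebra_reflected_deriv by (rule_tac bexI) auto
next
  case inverse_denom
  \<comment> \<open>The vanishing summands are kept so that \<open>d\<close> matches the two
    derivative formulas at \<open>m = 0\<close> verbatim.\<close>
  define d where "d x = (flat_exp (0 + 2) x - (0::nat) * flat_exp (0 + 1) x) +
    (- 1 * (flat_exp (0 + 2) (1 - x) - (0::nat) * flat_exp (0 + 1) (1 - x)))" for x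
  have d: "d \<in> step_algebra"
    unfolding d_def
    by (rule step_algebra.add[OF step_algebra_flat_deriv step_algebra_reflected_deriv])
  have "(step_denom has_real_derivative d x) (at x)" for x
    unfolding step_denom_def d_def
    by (rule DERIV_add[OF DERIV_flat_exp DERIV_flat_exp_reflected])
  then have "((\<lambda>x. inverse (step_denom x)) has_real_derivative
      - 1 * (inverse (step_denom x) * d x * inverse (step_denom x))) (at x)" for x
    using DERIV_inverse'[of step_denom "d x" x UNIV] step_denom_pos[of x] by simp
  moreover have "(\<lambda>x. - 1 * (inverse (step_denom x) * d x * inverse (step_denom x))) \<in> step_algebra"
    using d by (intro step_algebra.intros)
  ultimately show ?case
    by (rule_tac bexI) auto
next
  case (add f g)
  then obtain f' g' where "f' \<in> step_algebra" "g' \<in> step_algebra"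
    "\<And>x. (f has_real_derivative f' x) (at x)" "\<And>x. (g has_real_derivative g' x) (at x)" by blast
  then show ?case
    by (intro bexI[of _ "\<lambda>x. f' x + g' x"]) (auto intro: DERIV_add step_algebra.add)
next
  case (mult f g)
  then obtain f' g' where "f' \<in> step_algebra" "g' \<in> step_algebra"
    "\<And>x. (f has_real_derivative f' x) (at x)" "\<And>x. (g has_real_derivative g' x) (at x)" by blast
  with mult.hyps show ?case
    by (intro bexI[of _ "\<lambda>x. f' x * g x + g' x * f x"])
      (auto intro: DERIV_mult step_algebra.add step_algebra.mult)
qed

lemma smooth_fun_on_smooth_step:
  assumes "openin (Euclidean_space n) U" "smooth_fun_on n U f"
  shows "smooth_fun_on n U (\<lambda>x. smooth_step (f x))"
proof -
  have "smooth_step \<in> step_algebra"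
    unfolding smooth_step_def by (intro step_algebra.intros)
  with Ck_on_compose[OF assms(1) step_algebra_closed_deriv assms(2)] show ?thesis
    unfolding smooth_fun_on_def by blast
qed

lemma smooth_step_eq_0: "x \<le> 0 \<Longrightarrow> smooth_step x = 0"
  by (simp add: smooth_step_def flat_exp_def)

lemma smooth_step_eq_1: "1 \<le> x \<Longrightarrow> smooth_step x = 1"
  by (simp add: smooth_step_def step_denom_def flat_exp_def)

lemma flat_exp_0_mono: "x \<le> y \<Longrightarrow> flat_exp 0 x \<le> flat_exp 0 y"
  by (auto simp: flat_exp_def)

text \<open>After cross-multiplication the product \<open>flat_exp 0 x * flat_exp 0 y\<close>
  cancels, and the rest is monotonicity of \<open>flat_exp 0\<close>.\<close>

lemma smooth_step_mono:
  assumes "x \<le> y" shows "smooth_step x \<le> smooth_step y"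
proof -
  have "flat_exp 0 x * flat_exp 0 (1 - y) \<le> flat_exp 0 y * flat_exp 0 (1 - x)"
    using assms by (intro mult_mono flat_exp_0_mono) (auto simp: flat_exp_def)
  then have "flat_exp 0 x * step_denom y \<le> flat_exp 0 y * step_denom x"
    by (simp add: step_denom_def algebra_simps)
  then show ?thesis
    using step_denom_pos[of x] step_denom_pos[of y] by (simp add: smooth_step_def field_simps)
qed

lemma smooth_step_ge_0: "0 \<le> smooth_step x"
  using smooth_step_mono[of "min x 0" x] by (simp add: smooth_step_eq_0)

lemma smooth_step_le_1: "smooth_step x \<le> 1"
  using smooth_step_mono[of x "max x 1"] by (simp add: smooth_step_eq_1)

section \<open>The contracting homotopy\<close>

text \<open>The clock rises between 2j/5 and (2j+1)/5. The windows for j = 0, 1, 2 are separated by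
  pauses, which leave room for open conditions on time and on partial sums.\<close>

definition clock :: "nat \<Rightarrow> real \<Rightarrow> real" where
  "clock j x = smooth_step (5 * x - 2 * real j)"

lemma clock_eq_0: "5 * x \<le> 2 * real j \<Longrightarrow> clock j x = 0"
  by (simp add: clock_def smooth_step_eq_0)

lemma clock_eq_1: "2 * real j + 1 \<le> 5 * x \<Longrightarrow> clock j x = 1"
  by (simp add: clock_def smooth_step_eq_1)

lemma clock_mono: "x \<le> y \<Longrightarrow> clock j x \<le> clock j y"
  by (simp add: clock_def smooth_step_mono)

lemma clock_ge_0: "0 \<le> clock j x" and clock_le_1: "clock j x \<le> 1"
  by (simp_all add: clock_def smooth_step_ge_0 smooth_step_le_1)

lemma smooth_fun_on_clock:
  "openin (Euclidean_space n) U \<Longrightarrow> smooth_fun_on n U f \<Longrightarrow> smooth_fun_on n U (\<lambda>x. clock j (f x))"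
  unfolding clock_def
  by (intro smooth_fun_on_smooth_step smooth_fun_on_diff smooth_fun_on_mult smooth_fun_on_const)

definition partial_sum :: "(nat \<Rightarrow> real) \<Rightarrow> nat \<Rightarrow> real" where
  "partial_sum t i = (\<Sum>j<i. t j)"

text \<open>
  The three stages take place while \<open>clock 0 s\<close>, \<open>clock 1 s\<close> and \<open>clock 2 s\<close> rise from 0 to 1.
  Applied to partial sums, \<open>clock 0\<close> and \<open>clock 2\<close> also serve as the increasing functions \<open>f\<close> and \<open>h\<close> above.
\<close>

definition stay_weight :: "(nat \<Rightarrow> real) \<Rightarrow> real \<Rightarrow> nat \<Rightarrow> real" where
  "stay_weight t s i = (1 - clock 0 s) * t i +
     clock 0 s * (1 - clock 1 s) * (clock 0 (partial_sum t (Suc i)) - clock 0 (partial_sum t i))"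

text \<open>The leading factor complements the total of \<open>stay_weight\<close>, so that the sum
  is 1 at every time. Weight at \<open>Suc j\<close> stems from index \<open>j\<close>, which leaves
  index 0 to \<open>clock 2 s\<close>.\<close>

definition move_weight :: "(nat \<Rightarrow> real) \<Rightarrow> real \<Rightarrow> nat \<Rightarrow> real" where
  "move_weight t s i = clock 0 s * clock 1 s *
     (case i of 0 \<Rightarrow> clock 2 s
      | Suc j \<Rightarrow> (1 - clock 2 s) * (clock 2 (partial_sum t (Suc j)) - clock 2 (partial_sum t j)))"

definition shift_label :: "('a, 'b) monoid_scheme \<Rightarrow> (nat \<Rightarrow> 'a) \<Rightarrow> nat \<Rightarrow> 'a" where
  "shift_label G g i = (case i of 0 \<Rightarrow> \<one>\<^bsub>G\<^esub> | Suc j \<Rightarrow> g j)"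

text \<open>On \<open>milnor_S G\<close> the two weights at an index are never both nonzero, so the
  case distinction gives each nonzero weight its own label.\<close>

definition milnor_flow ::
    "('a, 'b) monoid_scheme \<Rightarrow> (nat \<Rightarrow> real) \<times> (nat \<Rightarrow> 'a) \<Rightarrow> real \<Rightarrow> (nat \<Rightarrow> real) \<times> (nat \<Rightarrow> 'a)" where
  "milnor_flow G q s =
     (\<lambda>i. stay_weight (fst q) s i + move_weight (fst q) s i,
      \<lambda>i. if stay_weight (fst q) s i \<noteq> 0 then snd q i else shift_label G (snd q) i)"

text \<open>The class of the result is independent of the chosen representative, by
  \<open>milnor_flow_cong\<close>.\<close>

definition EG_homotopy ::
    "('a, 'b) monoid_scheme \<Rightarrow> ((nat \<Rightarrow> real) \<times> (nat \<Rightarrow> 'a)) set \<times> real \<Rightarrow>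
      ((nat \<Rightarrow> real) \<times> (nat \<Rightarrow> 'a)) set" where
  "EG_homotopy G = (\<lambda>(y, s). milnor_rel G `` {milnor_flow G (SOME q. q \<in> y) s})"

section \<open>Signs and total of the deformed weights\<close>

lemma partial_sum_Suc: "partial_sum t (Suc i) = partial_sum t i + t i"
  by (simp add: partial_sum_def)

lemma partial_sum_0: "partial_sum t 0 = 0"
  by (simp add: partial_sum_def)

lemma partial_sum_mono:
  "(\<And>i. 0 \<le> t i) \<Longrightarrow> i \<le> j \<Longrightarrow> partial_sum t i \<le> partial_sum t j"
  unfolding partial_sum_def by (intro sum_mono2) auto

lemma partial_sum_eq_1:
  assumes "\<And>i. N \<le> i \<Longrightarrow> t i = 0" "partial_sum t N = 1" "N \<le> i"
  shows "partial_sum t i = 1"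
  using assms(3) by (induction i rule: dec_induct) (simp_all add: assms partial_sum_Suc)

lemma stay_weight_nonneg: "(\<And>i. 0 \<le> t i) \<Longrightarrow> 0 \<le> stay_weight t s i"
  unfolding stay_weight_def
  by (intro add_nonneg_nonneg mult_nonneg_nonneg)
    (auto simp: clock_ge_0 clock_le_1 partial_sum_Suc intro: clock_mono)

lemma move_weight_nonneg: "(\<And>i. 0 \<le> t i) \<Longrightarrow> 0 \<le> move_weight t s i"
  unfolding move_weight_def
  by (intro mult_nonneg_nonneg)
    (auto simp: clock_ge_0 clock_le_1 partial_sum_Suc split: nat.split
      intro!: mult_nonneg_nonneg clock_mono)

lemma stay_weight_zero: "t i = 0 \<Longrightarrow> stay_weight t s i = 0"
  by (simp add: stay_weight_def partial_sum_Suc)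

lemma move_weight_zero: "t j = 0 \<Longrightarrow> move_weight t s (Suc j) = 0"
  by (simp add: move_weight_def partial_sum_Suc)

text \<open>The increments of each clock telescope from its value at 0 to its value at 1. The range
  ends at \<open>Suc N\<close> since the shift carries weight from index \<open>N - 1\<close> to
  index \<open>N\<close>.\<close>

lemma sum_stay_move_weight:
  assumes "\<And>i. N \<le> i \<Longrightarrow> t i = 0" "partial_sum t N = 1"
  shows "(\<Sum>i<Suc N. stay_weight t s i + move_weight t s i) = 1"
proof -
  have T: "partial_sum t (Suc N) = 1" "partial_sum t N = 1"
    by (rule partial_sum_eq_1[OF assms]; simp)+
  have ends: "clock 0 0 = 0" "clock 0 1 = 1" "clock 2 0 = 0" "clock 2 1 = 1"
    by (auto intro: clock_eq_0 clock_eq_1)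
  have "(\<Sum>i<Suc N. stay_weight t s i) =
      (1 - clock 0 s) * partial_sum t (Suc N) +
      clock 0 s * (1 - clock 1 s) * (\<Sum>i<Suc N. clock 0 (partial_sum t (Suc i)) - clock 0 (partial_sum t i))"
    unfolding stay_weight_def sum.distrib sum_distrib_left[symmetric] by (simp only: partial_sum_def)
  also have "\<dots> = (1 - clock 0 s) + clock 0 s * (1 - clock 1 s)"
    unfolding sum_lessThan_telescope[of "\<lambda>i. clock 0 (partial_sum t i)"] T partial_sum_0 ends by simp
  finally have stay: "(\<Sum>i<Suc N. stay_weight t s i) = (1 - clock 0 s) + clock 0 s * (1 - clock 1 s)" .
  have "(\<Sum>i<Suc N. move_weight t s i) = clock 0 s * clock 1 s *
      (clock 2 s + (1 - clock 2 s) * (\<Sum>i<N. clock 2 (partial_sum t (Suc i)) - clock 2 (partial_sum t i)))"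
    unfolding move_weight_def sum_distrib_left[symmetric] sum.lessThan_Suc_shift
    by (simp add: sum_distrib_left)
  also have "\<dots> = clock 0 s * clock 1 s"
    unfolding sum_lessThan_telescope[of "\<lambda>i. clock 2 (partial_sum t i)"] T partial_sum_0 ends by simp
  finally show ?thesis
    unfolding sum.distrib stay by (simp add: algebra_simps)
qed

section \<open>Vanishing and smoothness of the deformed weights\<close>

lemma stay_weight_late: "3 \<le> 5 * s \<Longrightarrow> stay_weight t s i = 0"
  by (simp add: stay_weight_def clock_eq_1)

text \<open>The linear part is gone once \<open>clock 0 s = 1\<close>, and \<open>clock 0\<close> is
  already 1 at both ends of the increment.\<close>

lemma stay_weight_high:
  assumes "\<And>i. 0 \<le> t i" "1 \<le> 5 * s" "1 \<le> 5 * partial_sum t i"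
  shows "stay_weight t s i = 0"
  using assms(2,3) assms(1)[of i] by (simp add: stay_weight_def clock_eq_1 partial_sum_Suc)

text \<open>The second stage has not begun: \<open>clock 1 s = 0\<close>.\<close>

lemma move_weight_early: "5 * s \<le> 2 \<Longrightarrow> move_weight t s i = 0"
  by (simp add: move_weight_def clock_eq_0)

text \<open>At index 0 the weight carries the factor \<open>clock 2 s = 0\<close>. At
  \<open>Suc j\<close> the shift makes \<open>partial_sum t i\<close> the upper end of the
  increment, so \<open>clock 2\<close> is 0 at both ends; thus the same partial sum governs both
  kinds of weight.\<close>

lemma move_weight_low:
  assumes "\<And>i. 0 \<le> t i" "5 * s \<le> 4" "5 * partial_sum t i \<le> 4"
  shows "move_weight t s i = 0"
proof (cases i)
  case (Suc j)
  then show ?thesis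
    using assms(3) assms(1)[of j] by (simp add: move_weight_def clock_eq_0 partial_sum_Suc)
qed (use assms(2) in \<open>simp add: move_weight_def clock_eq_0\<close>)

lemma smooth_fun_on_partial_sum:
  "openin (Euclidean_space n) U \<Longrightarrow> (\<And>i. smooth_fun_on n U (\<lambda>u. t u i)) \<Longrightarrow>
    smooth_fun_on n U (\<lambda>u. partial_sum (t u) i)"
  unfolding partial_sum_def by (intro smooth_fun_on_sum)

lemma smooth_fun_on_stay_weight:
  assumes "openin (Euclidean_space n) U" "\<And>i. smooth_fun_on n U (\<lambda>u. t u i)" "smooth_fun_on n U s"
  shows "smooth_fun_on n U (\<lambda>u. stay_weight (t u) (s u) i)"
  unfolding stay_weight_def using assms
  by (intro smooth_fun_on_add smooth_fun_on_mult smooth_fun_on_diff smooth_fun_on_const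
      smooth_fun_on_clock smooth_fun_on_partial_sum)

lemma smooth_fun_on_move_weight:
  assumes "openin (Euclidean_space n) U" "\<And>i. smooth_fun_on n U (\<lambda>u. t u i)" "smooth_fun_on n U s"
  shows "smooth_fun_on n U (\<lambda>u. move_weight (t u) (s u) i)"
  unfolding move_weight_def using assms
  by (cases i; simp only: nat.case)
    (intro smooth_fun_on_mult smooth_fun_on_diff smooth_fun_on_const
      smooth_fun_on_clock smooth_fun_on_partial_sum; assumption)+

section \<open>The Milnor space and the flow on its classes\<close>

lemma milnor_S_iff:
  "(t, g) \<in> milnor_S G \<longleftrightarrow>
    (\<forall>i. 0 \<le> t i) \<and> (\<forall>i. g i \<in> carrier G) \<and> (\<exists>N. (\<forall>i\<ge>N. t i = 0) \<and> partial_sum t N = 1)"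
  (is "?L \<longleftrightarrow> ?R")
proof
  assume L: ?L
  then have "finite {i. t i \<noteq> 0}"
    by (simp add: milnor_S_def)
  then obtain N where N: "\<And>i. t i \<noteq> 0 \<Longrightarrow> i < N"
    unfolding finite_nat_set_iff_bounded by auto
  then have "(\<Sum>i | t i \<noteq> 0. t i) = partial_sum t N"
    unfolding partial_sum_def by (intro sum.mono_neutral_left) auto
  with L N show ?R
    by (auto simp: milnor_S_def intro!: exI[of _ N] dest: leD)
next
  assume R: ?R
  then obtain N where N: "\<And>i. N \<le> i \<Longrightarrow> t i = 0" "partial_sum t N = 1" by blast
  have supp: "{i. t i \<noteq> 0} \<subseteq> {..<N}"
    using N(1) by (auto simp: not_le[symmetric])
  then have "(\<Sum>i | t i \<noteq> 0. t i) = partial_sum t N"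
    unfolding partial_sum_def by (intro sum.mono_neutral_left) auto
  moreover have "t i \<le> 1" for i
  proof (cases "i < N")
    case True
    then have "t i \<le> partial_sum t N"
      unfolding partial_sum_def using R by (intro member_le_sum) auto
    with N show ?thesis by simp
  qed (simp add: N(1))
  ultimately show ?L
    using R N finite_subset[OF supp] by (auto simp: milnor_S_def)
qed

lemma equiv_milnor_rel: "equiv (milnor_S G) (milnor_rel G)"
  by (rule equivI) (auto simp: milnor_rel_def refl_on_def sym_def trans_def)

lemma milnor_rel_iff:
  "(q, q') \<in> milnor_rel G \<longleftrightarrow> q \<in> milnor_S G \<and> q' \<in> milnor_S G \<and> fst q = fst q' \<and>
     (\<forall>i. fst q i \<noteq> 0 \<longrightarrow> snd q i = snd q' i)"
  by (cases q; cases q') (auto simp: milnor_rel_def)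

text \<open>Labels are arbitrary here, so that the statement serves both \<open>milnor_flow\<close>
  and the local lift with fixed label choices in \<open>EG_homotopy_plot\<close>.\<close>

lemma milnor_flow_weights_in_milnor_S:
  assumes "q \<in> milnor_S G" "\<And>i. g i \<in> carrier G"
  shows "(\<lambda>i. stay_weight (fst q) s i + move_weight (fst q) s i, g) \<in> milnor_S G"
proof -
  obtain t h where q: "q = (t, h)" by (cases q)
  with assms obtain N where N: "\<And>i. 0 \<le> t i" "\<And>i. N \<le> i \<Longrightarrow> t i = 0" "partial_sum t N = 1"
    unfolding q milnor_S_iff by blast
  \<comment> \<open>Such an index is the successor of one that is at least \<open>N\<close>, so both
    weights stem from zero entries of \<open>t\<close>.\<close>
  have "\<forall>i\<ge>Suc N. stay_weight t s i + move_weight t s i = 0"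
    by (auto simp: Suc_le_eq N(2) stay_weight_zero move_weight_zero dest!: less_imp_Suc_add)
  moreover have "partial_sum (\<lambda>i. stay_weight t s i + move_weight t s i) (Suc N) = 1"
    using sum_stay_move_weight[OF N(2,3)] by (simp add: partial_sum_def)
  ultimately show ?thesis
    unfolding milnor_S_iff q fst_conv
    using assms(2) N(1) by (blast intro: add_nonneg_nonneg stay_weight_nonneg move_weight_nonneg)
qed

context
  fixes G :: "('a, 'b) monoid_scheme" and D :: "'a plots"
  assumes dg: "diffeological_group G D"
begin

lemma one_in_carrier: "\<one>\<^bsub>G\<^esub> \<in> carrier G"
  using dg by (simp add: diffeological_group_def group.is_monoid)

lemma shift_label_in_carrier: "(\<And>i. g i \<in> carrier G) \<Longrightarrow> shift_label G g i \<in> carrier G"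
  by (simp add: shift_label_def one_in_carrier split: nat.split)

lemma milnor_S_label: "q \<in> milnor_S G \<Longrightarrow> snd q i \<in> carrier G"
  by (cases q) (simp add: milnor_S_iff)

lemma milnor_flow_in_milnor_S: "q \<in> milnor_S G \<Longrightarrow> milnor_flow G q s \<in> milnor_S G"
  unfolding milnor_flow_def
  by (rule milnor_flow_weights_in_milnor_S) (simp_all add: milnor_S_label shift_label_in_carrier)

text \<open>The weights depend on \<open>fst\<close> only. A nonzero weight that uses the label
  \<open>g j\<close> forces \<open>t j\<close> to be nonzero, and there the two labels agree; the
  shifted label at index 0 is always the unit.\<close>

lemma milnor_flow_cong:
  assumes "(q, q') \<in> milnor_rel G"
  shows "(milnor_flow G q s, milnor_flow G q' s) \<in> milnor_rel G"
proof -
  have q: "q \<in> milnor_S G" "q' \<in> milnor_S G" "fst q = fst q'"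
    "\<And>i. fst q' i \<noteq> 0 \<Longrightarrow> snd q i = snd q' i"
    using assms by (auto simp: milnor_rel_iff)
  have "shift_label G (snd q) i = shift_label G (snd q') i"
    if "move_weight (fst q') s i \<noteq> 0" for i
    using that q(4) by (cases i) (auto simp: shift_label_def dest: contrapos_nn[OF _ move_weight_zero])
  moreover have "snd q i = snd q' i" if "stay_weight (fst q') s i \<noteq> 0" for i
    using that q(4) stay_weight_zero by blast
  ultimately show ?thesis
    using milnor_flow_in_milnor_S[OF q(1)] milnor_flow_in_milnor_S[OF q(2)] q(3)
    by (auto simp: milnor_rel_iff milnor_flow_def)
qed

lemma EG_homotopy_class:
  assumes "q \<in> milnor_S G"
  shows "EG_homotopy G (milnor_rel G `` {q}, s) = milnor_rel G `` {milnor_flow G q s}"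
proof -
  have "q \<in> milnor_rel G `` {q}"
    by (rule equiv_class_self[OF equiv_milnor_rel assms])
  then have "(q, SOME q'. q' \<in> milnor_rel G `` {q}) \<in> milnor_rel G"
    using someI[of "\<lambda>q'. q' \<in> milnor_rel G `` {q}" q] by simp
  then show ?thesis
    using equiv_class_eq[OF equiv_milnor_rel milnor_flow_cong] by (simp add: EG_homotopy_def)
qed

section \<open>Local lifts and smoothness of the homotopy\<close>

lemma plot_subset:
  assumes "D n V p" "openin (Euclidean_space n) W" "W \<subseteq> V"
  shows "D n W p"
proof -
  have "smooth_between n W n V (\<lambda>x. x)"
    using assms by (auto simp: smooth_between_def intro: smooth_fun_on_coordinate)
  then have "D n W (p \<circ> (\<lambda>x. x))"
    using dg assms unfolding diffeological_group_def diffeology_on_def by blast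
  then show ?thesis
    by (simp add: o_def)
qed

lemma plot_const:
  "openin (Euclidean_space n) W \<Longrightarrow> x \<in> carrier G \<Longrightarrow> D n W (\<lambda>_. x)"
proof -
  have "\<forall>n U. \<forall>x\<in>carrier G. openin (Euclidean_space n) U \<longrightarrow> D n U (\<lambda>_. x)"
    using dg unfolding diffeological_group_def diffeology_on_def by (elim conjE)
  then show "openin (Euclidean_space n) W \<Longrightarrow> x \<in> carrier G \<Longrightarrow> D n W (\<lambda>_. x)"
    by simp
qed

text \<open>Here \<open>b i\<close> says that index \<open>i\<close> takes the shifted label
  throughout \<open>W\<close>. Early or late in time a constant choice works; in between, the
  partial sums at \<open>u\<close> decide, and monotonicity reduces infinitely many conditions to
  finitely many.\<close>

lemma locally_decided_labels:
  assumes V: "openin (Euclidean_space n) V" "u \<in> V"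
    and t: "\<And>i. smooth_fun_on n V (\<lambda>v. t v i)" and s: "smooth_fun_on n V s"
    and nonneg: "\<And>v i. v \<in> V \<Longrightarrow> 0 \<le> t v i"
    and N: "\<And>i. N \<le> i \<Longrightarrow> t u i = 0" "partial_sum (t u) N = 1"
  obtains W b where "openin (Euclidean_space n) W" "u \<in> W" "W \<subseteq> V"
    "\<And>v i. v \<in> W \<Longrightarrow> b i \<Longrightarrow> stay_weight (t v) (s v) i = 0"
    "\<And>v i. v \<in> W \<Longrightarrow> \<not> b i \<Longrightarrow> move_weight (t v) (s v) i = 0"
proof -
  note preimage = smooth_fun_on_openin_preimage[OF V(1)]
  \<comment> \<open>All three conditions are open, and each fits one pair of vanishing lemmas for
    the weights.\<close>
  consider "s u < 2/5" | "s u > 3/5" | "1/5 < s u" "s u < 4/5"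
    by linarith
  then show thesis
  proof cases
    case 1
    show ?thesis
      by (rule that[of "{v \<in> V. s v \<in> {..<2/5}}" "\<lambda>_. False"])
        (use 1 V(2) preimage[OF s, of "{..<2/5}"] in \<open>auto intro!: move_weight_early\<close>)
  next
    case 2
    show ?thesis
      by (rule that[of "{v \<in> V. s v \<in> {3/5<..}}" "\<lambda>_. True"])
        (use 2 V(2) preimage[OF s, of "{3/5<..}"] in \<open>auto intro!: stay_weight_late\<close>)
  next
    case 3
    \<comment> \<open>If this fails, the sum at \<open>u\<close> is at most 1/5, hence strictly
      below 4/5; either way a strict inequality persists near \<open>u\<close>.\<close>
    define b where "b i \<longleftrightarrow> partial_sum (t u) i > 1/5" for i
    \<comment> \<open>Only indices up to \<open>N\<close> are constrained, so that the intersection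
      is finite and stays open.\<close>
    define W where "W = {v \<in> V. s v \<in> {1/5<..<4/5}} \<inter>
      (\<Inter>i\<le>N. {v \<in> V. partial_sum (t v) i \<in> (if b i then {1/5<..} else {..<4/5})})"
    have "openin (Euclidean_space n) W"
      unfolding W_def
      by (intro openin_Int openin_INT2 preimage smooth_fun_on_partial_sum s t V(1)) auto
    have "u \<in> W"
      using 3 V(2) by (auto simp: W_def b_def)
    have sums: "partial_sum (t v) i \<in> (if b i then {1/5<..} else {..<4/5})" if "v \<in> W" "i \<le> N" for v i
      using that unfolding W_def by blast
    have W: "v \<in> V" "1/5 < s v" "s v < 4/5" if "v \<in> W" for v
      using that by (auto simp: W_def)
    have b: "1/5 < partial_sum (t v) i" if "v \<in> W" "b i" for v i
    proof (cases "i \<le> N")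
      case True
      from sums[OF that(1) this] that(2) show ?thesis by simp
    next
      case False
      \<comment> \<open>At \<open>N\<close> the partial sum exceeds 1/5 on all of \<open>W\<close>,
        and monotonicity passes this on to every larger index at once.\<close>
      have "b N"
        using N(2) by (simp add: b_def)
      then have "1/5 < partial_sum (t v) N"
        using sums[OF that(1), of N] by simp
      also have "\<dots> \<le> partial_sum (t v) i"
        using W(1)[OF that(1)] False nonneg by (intro partial_sum_mono) auto
      finally show ?thesis .
    qed
    have not_b: "partial_sum (t v) i < 4/5" if "v \<in> W" "\<not> b i" for v i
    proof -
      \<comment> \<open>From \<open>N\<close> on the partial sums at \<open>u\<close> equal 1, so
        \<open>b\<close> holds there.\<close>
      have "i \<le> N"
        using that(2) partial_sum_eq_1[of N "t u" i, OF N] by (force simp: b_def)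
      from sums[OF that(1) this] that(2) show ?thesis by simp
    qed
    show ?thesis
    proof (rule that[of W b])
      show "W \<subseteq> V"
        using W by blast
      show "stay_weight (t v) (s v) i = 0" if "v \<in> W" "b i" for v i
        using b[OF that] W[OF that(1)] nonneg by (intro stay_weight_high) auto
      show "move_weight (t v) (s v) i = 0" if "v \<in> W" "\<not> b i" for v i
        using not_b[OF that] W[OF that(1)] nonneg by (intro move_weight_low) auto
    qed fact+
  qed
qed

text \<open>The labels of \<open>milnor_flow\<close> may jump along a plot. Fixing them by
  \<open>b\<close> gives a smooth lift in the same classes.\<close>

lemma EG_homotopy_plot:
  assumes p: "EG_plots G D n U (fst \<circ> p)" "unit_interval_plots n U (snd \<circ> p)"
  shows "EG_plots G D n U (EG_homotopy G \<circ> p)"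
  unfolding EG_plots_def quotient_plots_def
proof (intro conjI ballI)
  show "openin (Euclidean_space n) U"
    using p(1) by (simp add: EG_plots_def quotient_plots_def)
next
  fix u assume "u \<in> U"
  with p(1) obtain V q where V: "openin (Euclidean_space n) V" "u \<in> V" "V \<subseteq> U"
    and q: "milnor_S_plots G D n V q" "\<And>v. v \<in> V \<Longrightarrow> fst (p v) = milnor_rel G `` {q v}"
    by (auto simp: EG_plots_def quotient_plots_def)
  define t where "t v = fst (q v)" for v
  define s where "s v = snd (p v)" for v
  have S: "q v \<in> milnor_S G" if "v \<in> V" for v
    using q(1) that by (auto simp: milnor_S_plots_def subset_plots_def)
  have t: "smooth_fun_on n V (\<lambda>v. t v i)" for i
    using q(1) by (auto simp: milnor_S_plots_def subset_plots_def prod_plots_def power_plots_def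
        unit_interval_plots_def real_plots_def t_def)
  have g: "D n V (\<lambda>v. snd (q v) i)" for i
    using q(1) by (auto simp: milnor_S_plots_def subset_plots_def prod_plots_def power_plots_def)
  have s: "smooth_fun_on n V s"
    using p(2) V(3) by (auto simp: unit_interval_plots_def subset_plots_def real_plots_def s_def[abs_def]
        o_def[abs_def] intro: smooth_fun_on_subset)
  have nonneg: "0 \<le> t v i" if "v \<in> V" for v i
    using S[OF that] by (cases "q v") (simp add: t_def milnor_S_iff)
  obtain N where N: "\<And>i. N \<le> i \<Longrightarrow> t u i = 0" "partial_sum (t u) N = 1"
    using S[OF V(2)] by (cases "q u") (auto simp: t_def milnor_S_iff)
  obtain W b where W: "openin (Euclidean_space n) W" "u \<in> W" "W \<subseteq> V"
    and b: "\<And>v i. v \<in> W \<Longrightarrow> b i \<Longrightarrow> stay_weight (t v) (s v) i = 0"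
      "\<And>v i. v \<in> W \<Longrightarrow> \<not> b i \<Longrightarrow> move_weight (t v) (s v) i = 0"
    using locally_decided_labels[OF V(1,2) t s nonneg N] by blast
  \<comment> \<open>The weights are those of the flow, but the choice of label no longer depends on
    \<open>v\<close>.\<close>
  define r where "r v = (\<lambda>i. stay_weight (t v) (s v) i + move_weight (t v) (s v) i,
    \<lambda>i. if b i then shift_label G (snd (q v)) i else snd (q v) i)" for v
  have rS: "r v \<in> milnor_S G" if "v \<in> W" for v
    unfolding r_def t_def using S W(3) that
    by (intro milnor_flow_weights_in_milnor_S) (auto simp: milnor_S_label shift_label_in_carrier)
  have "unit_interval_plots n W (\<lambda>v. fst (r v) i)" for i
  proof -
    have "smooth_fun_on n W (\<lambda>v. fst (r v) i)"
      unfolding r_def fst_conv using W(1) smooth_fun_on_subset[OF t W(3)] smooth_fun_on_subset[OF s W(3)]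
      by (intro smooth_fun_on_add smooth_fun_on_stay_weight smooth_fun_on_move_weight)
    moreover have "fst (r v) i \<in> {0..1}" if "v \<in> W" for v
      using rS[OF that] by (auto simp: milnor_S_def)
    ultimately show ?thesis
      using W(1) by (auto simp: unit_interval_plots_def subset_plots_def real_plots_def)
  qed
  moreover have "D n W (\<lambda>v. snd (r v) i)" for i
    using plot_subset[OF g W(1,3)] plot_const[OF W(1) one_in_carrier]
    by (cases i; cases "b i") (simp_all add: r_def shift_label_def)
  ultimately have "milnor_S_plots G D n W r"
    using rS by (auto simp: milnor_S_plots_def subset_plots_def prod_plots_def power_plots_def)
  moreover have "(EG_homotopy G \<circ> p) v = milnor_rel G `` {r v}" if "v \<in> W" for v
  proof -
    have v: "v \<in> V"
      using that W(3) by blast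
    \<comment> \<open>If \<open>b i\<close>, the stay weight vanishes and the flow takes the shifted
      label too. Otherwise the move weight vanishes, so a nonzero total is a nonzero stay weight and
      both keep the old label.\<close>
    have "(milnor_flow G (q v) (s v), r v) \<in> milnor_rel G"
      using b[OF that] rS[OF that] milnor_flow_in_milnor_S[OF S[OF v]]
      by (auto simp: milnor_rel_iff milnor_flow_def r_def t_def)
    then have "milnor_rel G `` {milnor_flow G (q v) (s v)} = milnor_rel G `` {r v}"
      by (rule equiv_class_eq[OF equiv_milnor_rel])
    moreover have "p v = (milnor_rel G `` {q v}, s v)"
      using q(2)[OF v] by (simp add: s_def prod_eq_iff)
    ultimately show ?thesis
      by (simp add: EG_homotopy_class[OF S[OF v]])
  qed
  ultimately show "\<exists>V q. openin (Euclidean_space n) V \<and> u \<in> V \<and> V \<subseteq> U \<and>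
      milnor_S_plots G D n V q \<and> (\<forall>v\<in>V. (EG_homotopy G \<circ> p) v = milnor_rel G `` {q v})"
    using W V(3) by (intro exI[of _ W] exI[of _ r]) auto
qed

end

section \<open>Endpoints of the homotopy and contractibility\<close>

theorem proposition5p1:
  fixes G :: "('a, 'b) monoid_scheme" and D :: "'a plots"
  assumes "diffeological_group G D"
  shows "smoothly_contractible (EG G) (EG_plots G D)"
proof -
  \<comment> \<open>The vertex of index 0 with unit label, where the third stage collects all
    mass.\<close>
  define c :: "(nat \<Rightarrow> real) \<times> (nat \<Rightarrow> 'a)"
    where "c = (\<lambda>i. if i = 0 then 1 else 0, \<lambda>_. \<one>\<^bsub>G\<^esub>)"
  have cS: "c \<in> milnor_S G"
    unfolding c_def milnor_S_iff
    by (auto simp: one_in_carrier[OF assms] partial_sum_def intro!: exI[of _ "Suc 0"])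
  have EG_cases: "\<exists>q\<in>milnor_S G. y = milnor_rel G `` {q}" if "y \<in> EG G" for y
    using that by (auto simp: EG_def elim: quotientE)
  have start: "EG_homotopy G (y, 0) = y" if y: "y \<in> EG G" for y
  proof -
    obtain q where q: "q \<in> milnor_S G" "y = milnor_rel G `` {q}"
      using EG_cases[OF y] by blast
    have w: "stay_weight t 0 i = t i" "move_weight t 0 i = 0" for t i
      by (simp_all add: stay_weight_def move_weight_early clock_eq_0)
    have "fst (milnor_flow G q 0) = fst q" "fst q i \<noteq> 0 \<Longrightarrow> snd (milnor_flow G q 0) i = snd q i" for i
      by (simp_all add: milnor_flow_def w)
    then have "(milnor_flow G q 0, q) \<in> milnor_rel G"
      using q(1) milnor_flow_in_milnor_S[OF assms q(1)] by (simp add: milnor_rel_iff)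
    then show ?thesis
      unfolding q(2) EG_homotopy_class[OF assms q(1)] by (rule equiv_class_eq[OF equiv_milnor_rel])
  qed
  have finish: "EG_homotopy G (y, 1) = milnor_rel G `` {c}" if y: "y \<in> EG G" for y
  proof -
    obtain q where q: "q \<in> milnor_S G" "y = milnor_rel G `` {q}"
      using EG_cases[OF y] by blast
    have w: "stay_weight t 1 i = 0" "move_weight t 1 i = (if i = 0 then 1 else 0)" for t i
      by (simp_all add: stay_weight_late move_weight_def clock_eq_1 split: nat.split)
    have "fst (milnor_flow G q 1) = fst c" "fst c i \<noteq> 0 \<Longrightarrow> snd (milnor_flow G q 1) i = snd c i" for i
      by (auto simp: milnor_flow_def w c_def shift_label_def split: if_splits)
    then have "(milnor_flow G q 1, c) \<in> milnor_rel G"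
      using cS milnor_flow_in_milnor_S[OF assms q(1)] by (simp add: milnor_rel_iff)
    then show ?thesis
      unfolding q(2) EG_homotopy_class[OF assms q(1)] by (rule equiv_class_eq[OF equiv_milnor_rel])
  qed
  have "EG_homotopy G (y, s) \<in> EG G" if "y \<in> EG G" for y s
    using EG_cases[OF that] by
      (auto simp: EG_homotopy_class[OF assms] EG_def intro!: quotientI milnor_flow_in_milnor_S[OF assms])
  then have "diffeo_smooth (EG G \<times> {0..1}) (prod_plots (EG_plots G D) unit_interval_plots)
      (EG G) (EG_plots G D) (EG_homotopy G)"
    by (auto simp: diffeo_smooth_def prod_plots_def intro: EG_homotopy_plot[OF assms])
  moreover have "milnor_rel G `` {c} \<in> EG G"
    unfolding EG_def by (rule quotientI[OF cS])
  ultimately show ?thesis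
    unfolding smoothly_contractible_def using start finish by blast
qed

end
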